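(* Let $\Lambda=\langle A\rangle$ be a numerical semigroup of embedding dimension $n\ge 2$, where $A=\{a_1,\dots,a_n\}$ is its minimal system of generators. Let $x\in\Lambda$ and let $I=\Lambda\setminus B(x)$ be the corresponding irreducible ideal. If $|G_I(\Lambda)|=6$, then $x$ satisfies one of the following, for some generators $a_i,a_j,a_k,a_l,a_m,a_q\in A$: (1) $x=6a_i$; (2) $x=4a_i=3a_j$; (3) $x=5a_i=2a_j$; (4) $x=4a_i$ and $x=a_j+a_k$; (5) $x=4a_i$ and $3a_i=2a_k$; (6) $x=2a_i$ and $x=2a_k+a_l$; (7) $x=3a_i$, $x=2a_j$ and $x=a_k+a_l$; (8) $x=2a_i$, $x=a_k+a_l$ and $x=a_m+a_q$.
   Context: A numerical semigroup is a submonoid $\Lambda$ of $(\mathbb{Z}_{\ge 0},+)$ with finite complement; its embedding dimension is the cardinality of its minimal system of generators. For $x\in\Lambda$, $B(x)=\{y\in\Lambda: x-y\in\Lambda\}$. An ideal of $\Lambda$ is a nonempty subset $I\subset\Lambda$ with $I+\Lambda\subset I$; the irreducible ideals are of the form $\Lambda\setminus B(x)$, $x\in\Lambda$. The graph $G_I(\Lambda)$ is the simple graph with vertex set $\{v_i : i\in(\Lambda\setminus I)\setminus\{0\}\}$ in which distinct vertices $v_i,v_j$ are adjacent if and only if $i+j\in I$; thus for $I=\Lambda\setminus B(x)$ its vertices are indexed by $B(x)\setminus\{0\}$. $|G|$ denotes the order (number of vertices) of $G$. *)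

theory Defs
  imports Complex_Main "HOL.Hull" "Graph_Theory.Pair_Digraph"
begin

definition nat_submonoid :: "nat set \<Rightarrow> bool" where
  "nat_submonoid M \<longleftrightarrow> 0 \<in> M \<and> (\<forall>a\<in>M. \<forall>b\<in>M. a + b \<in> M)"

definition numerical_semigroup :: "nat set \<Rightarrow> bool" where
  "numerical_semigroup \<Lambda> \<longleftrightarrow> nat_submonoid \<Lambda> \<and> finite (- \<Lambda>)"

definition generated :: "nat set \<Rightarrow> nat set" where
  "generated A = nat_submonoid hull A"

definition minimal_generating_set :: "nat set \<Rightarrow> nat set \<Rightarrow> bool" where
  "minimal_generating_set \<Lambda> A \<longleftrightarrow> generated A = \<Lambda> \<and> (\<forall>C. C \<subset> A \<longrightarrow> generated C \<noteq> \<Lambda>)"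

(* The description is well defined: see ex1_minimal_generating_set below. *)
definition embedding_dimension :: "nat set \<Rightarrow> nat" where
  "embedding_dimension \<Lambda> = card (THE A. minimal_generating_set \<Lambda> A)"

(* The guard y \<le> x is needed because subtraction on nat truncates. *)
definition divisors_in :: "nat set \<Rightarrow> nat \<Rightarrow> nat set" where
  "divisors_in \<Lambda> x = {y \<in> \<Lambda>. y \<le> x \<and> x - y \<in> \<Lambda>}"

definition semigroup_ideal :: "nat set \<Rightarrow> nat set \<Rightarrow> bool" where
  "semigroup_ideal \<Lambda> I \<longleftrightarrow> I \<noteq> {} \<and> I \<subseteq> \<Lambda> \<and> (\<forall>i\<in>I. \<forall>s\<in>\<Lambda>. i + s \<in> I)"

(* The vertex v_i is represented by i itself, and an undirected edge by the two arcs
   joining its ends, so that a simple graph is a pair_graph. *)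
definition ideal_graph :: "nat set \<Rightarrow> nat set \<Rightarrow> nat pair_pre_digraph" where
  "ideal_graph \<Lambda> I =
    \<lparr> pverts = (\<Lambda> - I) - {0},
      parcs = {(i, j). i \<in> (\<Lambda> - I) - {0} \<and> j \<in> (\<Lambda> - I) - {0} \<and> i \<noteq> j \<and> i + j \<in> I} \<rparr>"

definition graph_order :: "'a pair_pre_digraph \<Rightarrow> nat" where
  "graph_order G = card (pverts G)"

lemma submonoid_generated: "nat_submonoid (generated A)"
  unfolding generated_def by (rule hull_in) (auto simp: nat_submonoid_def)

lemma minimal_generating_set_iff:
  assumes "nat_submonoid \<Lambda>"
  shows "minimal_generating_set \<Lambda> A \<longleftrightarrow>
    A = {a \<in> \<Lambda> - {0}. \<not> (\<exists>b\<in>\<Lambda> - {0}. \<exists>c\<in>\<Lambda> - {0}. a = b + c)}" (is "_ \<longleftrightarrow> A = ?P")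
proof -
  have gen: "generated ?P = \<Lambda>"
  proof
    show "generated ?P \<subseteq> \<Lambda>"
      unfolding generated_def by (rule hull_minimal) (use assms in auto)
    have "y \<in> generated ?P" if "y \<in> \<Lambda>" for y
      using that
    proof (induction y rule: less_induct)
      case (less y)
      show ?case
      proof (cases "y = 0 \<or> y \<in> ?P")
        case True
        then show ?thesis
          using submonoid_generated[of ?P] hull_inc[of y ?P nat_submonoid]
          by (auto simp: nat_submonoid_def generated_def)
      next
        case False
        then obtain b c where "b \<in> \<Lambda> - {0}" "c \<in> \<Lambda> - {0}" "y = b + c"
          using less.prems by blast
        then have "b \<in> generated ?P" "c \<in> generated ?P"
          using less.IH[of b] less.IH[of c] by auto
        with \<open>y = b + c\<close> show ?thesis
          using submonoid_generated[of ?P] unfolding nat_submonoid_def by blast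
      qed
    qed
    then show "\<Lambda> \<subseteq> generated ?P" by blast
  qed
  have sub: "?P \<subseteq> C" if C: "generated C = \<Lambda>" for C
  proof
    fix p assume p: "p \<in> ?P"
    show "p \<in> C"
    proof (rule ccontr)
      assume "p \<notin> C"
      then have "C \<subseteq> \<Lambda> - {p}"
        using C hull_inc[of _ C nat_submonoid] by (auto simp: generated_def)
      moreover have "a + b \<noteq> p" if "a \<in> \<Lambda> - {p}" "b \<in> \<Lambda> - {p}" for a b
      proof
        assume e: "a + b = p"
        with that have "a \<noteq> 0" "b \<noteq> 0" by auto
        with e that p show False by blast
      qed
      then have "nat_submonoid (\<Lambda> - {p})"
        using assms p by (auto simp: nat_submonoid_def)
      ultimately have "generated C \<subseteq> \<Lambda> - {p}"
        unfolding generated_def by (rule hull_minimal)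
      with C p show False by blast
    qed
  qed
  show ?thesis
  proof
    assume "minimal_generating_set \<Lambda> A"
    then have A: "generated A = \<Lambda>" and min: "\<forall>C. C \<subset> A \<longrightarrow> generated C \<noteq> \<Lambda>"
      by (auto simp only: minimal_generating_set_def)
    from min gen have "\<not> ?P \<subset> A" by (metis (lifting))
    with sub[OF A] show "A = ?P" by (simp only: psubset_eq) simp
  next
    assume A: "A = ?P"
    have "generated C \<noteq> \<Lambda>" if "C \<subset> ?P" for C
    proof
      assume "generated C = \<Lambda>"
      from leD[OF sub[OF this]] that show False by contradiction
    qed
    with gen show "minimal_generating_set \<Lambda> A"
      unfolding minimal_generating_set_def A by (intro conjI allI impI)
  qed
qed

lemma ex1_minimal_generating_set:
  "numerical_semigroup \<Lambda> \<Longrightarrow> \<exists>!A. minimal_generating_set \<Lambda> A"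
  by (simp add: minimal_generating_set_iff numerical_semigroup_def)

lemma semigroup_ideal_compl_divisors_in:
  assumes "numerical_semigroup \<Lambda>"
  shows "semigroup_ideal \<Lambda> (\<Lambda> - divisors_in \<Lambda> x)"
proof -
  have add: "a + b \<in> \<Lambda>" if "a \<in> \<Lambda>" "b \<in> \<Lambda>" for a b
    using assms that by (simp add: numerical_semigroup_def nat_submonoid_def)
  have "finite (divisors_in \<Lambda> x)"
    by (rule finite_subset[of _ "{..x}"]) (auto simp: divisors_in_def)
  moreover have "infinite \<Lambda>"
    using assms by (metis numerical_semigroup_def finite_compl infinite_UNIV_nat)
  ultimately have "\<Lambda> - divisors_in \<Lambda> x \<noteq> {}"
    by (metis Diff_infinite_finite finite.emptyI)
  moreover have "i \<in> divisors_in \<Lambda> x" if "i \<in> \<Lambda>" "s \<in> \<Lambda>" "i + s \<in> divisors_in \<Lambda> x" for i s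
  proof -
    have e: "(x - (i + s)) + s = x - i" and le: "i \<le> x" and m: "x - (i + s) \<in> \<Lambda>"
      using that(3) by (auto simp: divisors_in_def)
    have "(x - (i + s)) + s \<in> \<Lambda>"
      using m that(2) add by blast
    with e le that(1) show ?thesis by (simp add: divisors_in_def)
  qed
  ultimately show ?thesis
    unfolding semigroup_ideal_def using add by blast
qed

lemma pair_graph_ideal_graph:
  assumes "numerical_semigroup \<Lambda>" "semigroup_ideal \<Lambda> I"
  shows "pair_graph (ideal_graph \<Lambda> I)"
proof -
  obtain i where i: "i \<in> I" "i \<in> \<Lambda>"
    using assms(2) by (auto simp: semigroup_ideal_def)
  have "\<Lambda> - I \<subseteq> {..i} \<union> (+) i ` (- \<Lambda>)"
  proof
    fix y assume y: "y \<in> \<Lambda> - I"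
    show "y \<in> {..i} \<union> (+) i ` (- \<Lambda>)"
    proof (cases "y \<le> i")
      case False
      then have e: "y = i + (y - i)" by simp
      then have "y - i \<notin> \<Lambda>"
        using y i assms(2) by (metis DiffD2 semigroup_ideal_def)
      with e show ?thesis by blast
    qed simp
  qed
  moreover have "finite ({..i} \<union> (+) i ` (- \<Lambda>))"
    using assms(1) by (simp add: numerical_semigroup_def)
  ultimately have fin: "finite (\<Lambda> - I)" by (rule finite_subset)
  have "finite (parcs (ideal_graph \<Lambda> I))"
    by (rule finite_subset[of _ "(\<Lambda> - I) \<times> (\<Lambda> - I)"]) (use fin in \<open>auto simp: ideal_graph_def\<close>)
  moreover have "symmetric (with_proj (ideal_graph \<Lambda> I))"
  proof -
    have "arcs_ends (with_proj (ideal_graph \<Lambda> I)) = parcs (ideal_graph \<Lambda> I)"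
      by (simp add: arcs_ends_def arc_to_ends_def with_proj_def)
    then show ?thesis
      by (simp add: symmetric_def sym_def ideal_graph_def add.commute)
  qed
  ultimately show ?thesis
    using fin by unfold_locales (auto simp: ideal_graph_def)
qed

end

theory Submission
  imports Defs
begin

text \<open>The set of proper nonzero divisors of x in the semigroup has five elements
  b1 < b2 < b3 < b4 < b5, and the involution y \<mapsto> x - y reverses it, so that
  x = b1 + b5 = b2 + b4 = 2 * b3. Divisors of divisors of x divide x, so each b_i is either a
  minimal generator or a sum of two smaller ones among the b_j; going through the
  possible sums leaves exactly the listed shapes.\<close>

text \<open>On \<open>P\<close> no subtraction truncates, so the reflection is injective and
  order-reversing; the mapped reversed list is therefore again a sorted distinct list with element
  set \<open>P\<close>, and such a list is unique.\<close>

lemma sorted_list_of_set_reflect: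
  fixes P :: "nat set"
  assumes "finite P" and "\<And>y. y \<in> P \<Longrightarrow> y \<le> x \<and> x - y \<in> P"
  shows "map (\<lambda>y. x - y) (rev (sorted_list_of_set P)) = sorted_list_of_set P"
proof (rule sorted_distinct_set_unique)
  have inj: "inj_on (\<lambda>y. x - y) P"
    by (rule inj_onI) (metis assms(2) diff_diff_cancel)
  have "sorted_wrt (\<lambda>u v. x - v \<le> x - u) (sorted_list_of_set P)"
    by (rule sorted_wrt_mono_rel[OF _ sorted_sorted_list_of_set]) auto
  then show "sorted (map (\<lambda>y. x - y) (rev (sorted_list_of_set P)))"
    by (simp add: sorted_wrt_map sorted_wrt_rev)
  show "distinct (map (\<lambda>y. x - y) (rev (sorted_list_of_set P)))"
    using assms(1) inj by (simp add: distinct_map)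
  show "sorted (sorted_list_of_set P)" "distinct (sorted_list_of_set P)"
    by simp_all
  have "(\<lambda>y. x - y) ` P = P"
    using assms by (force simp: image_iff)
  then show "set (map (\<lambda>y. x - y) (rev (sorted_list_of_set P))) = set (sorted_list_of_set P)"
    using assms(1) by simp
qed

theorem theorem2p4:
  fixes \<Lambda> A I :: "nat set" and n x :: nat
  assumes "numerical_semigroup \<Lambda>"
    and "minimal_generating_set \<Lambda> A"
    and "embedding_dimension \<Lambda> = n"
    and "n \<ge> 2"
    and "x \<in> \<Lambda>"
    and "I = \<Lambda> - divisors_in \<Lambda> x"
    and "graph_order (ideal_graph \<Lambda> I) = 6"
  shows
    "(\<exists>ai\<in>A. x = 6 * ai) \<or>
     (\<exists>ai\<in>A. \<exists>aj\<in>A. distinct [ai, aj] \<and> x = 4 * ai \<and> x = 3 * aj) \<or>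
     (\<exists>ai\<in>A. \<exists>aj\<in>A. distinct [ai, aj] \<and> x = 5 * ai \<and> x = 2 * aj) \<or>
     (\<exists>ai\<in>A. \<exists>aj\<in>A. \<exists>ak\<in>A. distinct [ai, aj, ak] \<and> x = 4 * ai \<and> x = aj + ak) \<or>
     (\<exists>ai\<in>A. \<exists>ak\<in>A. distinct [ai, ak] \<and> x = 4 * ai \<and> 3 * ai = 2 * ak) \<or>
     (\<exists>ai\<in>A. \<exists>ak\<in>A. \<exists>al\<in>A. distinct [ai, ak, al] \<and> x = 2 * ai \<and> x = 2 * ak + al) \<or>
     (\<exists>ai\<in>A. \<exists>aj\<in>A. \<exists>ak\<in>A. \<exists>al\<in>A. distinct [ai, aj, ak, al] \<and>
        x = 3 * ai \<and> x = 2 * aj \<and> x = ak + al) \<or>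
     (\<exists>ai\<in>A. \<exists>ak\<in>A. \<exists>al\<in>A. \<exists>am\<in>A. \<exists>aq\<in>A. distinct [ai, ak, al, am, aq] \<and>
        x = 2 * ai \<and> x = ak + al \<and> x = am + aq)"
proof -
  have add: "a + b \<in> \<Lambda>" if "a \<in> \<Lambda>" "b \<in> \<Lambda>" for a b
    using assms(1) that by (simp add: numerical_semigroup_def nat_submonoid_def)
  have zero: "0 \<in> \<Lambda>"
    using assms(1) by (simp add: numerical_semigroup_def nat_submonoid_def)
  have A: "A = {a \<in> \<Lambda> - {0}. \<not> (\<exists>b\<in>\<Lambda> - {0}. \<exists>c\<in>\<Lambda> - {0}. a = b + c)}"
    using assms(1,2) minimal_generating_set_iff by (simp add: numerical_semigroup_def)
  \<comment> \<open>The vertex of \<open>x\<close> itself is dropped too: this leaves five of the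
    six vertices, on which reflection in \<open>x\<close> is an involution.\<close>
  define P where "P = divisors_in \<Lambda> x - {0, x}"
  have finB: "finite (divisors_in \<Lambda> x)"
    by (rule finite_subset[of _ "{..x}"]) (auto simp: divisors_in_def)
  have "\<Lambda> - I = divisors_in \<Lambda> x"
    using assms(6) by (auto simp: divisors_in_def)
  then have card6: "card (divisors_in \<Lambda> x - {0}) = 6"
    using assms(7) by (simp add: graph_order_def ideal_graph_def)
  have "x \<noteq> 0"
  proof
    assume "x = 0"
    then have "divisors_in \<Lambda> x - {0} = {}" by (auto simp: divisors_in_def)
    with card6 show False by (metis card.empty zero_neq_numeral)
  qed
  moreover have "x \<in> divisors_in \<Lambda> x"
    using assms(5) zero by (simp add: divisors_in_def)
  moreover have "P = (divisors_in \<Lambda> x - {0}) - {x}"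
    by (auto simp: P_def)
  ultimately have cardP: "card P = 5"
    using card6 finB by simp
  have finP: "finite P" using finB by (simp add: P_def)
  have P_iff: "y \<in> P \<longleftrightarrow> y \<in> \<Lambda> \<and> 0 < y \<and> y < x \<and> x - y \<in> \<Lambda>" for y
    by (auto simp: P_def divisors_in_def)
  \<comment> \<open>The complement of \<open>u\<close> is \<open>v\<close> plus the complement of
    \<open>u + v\<close>. The alternative \<open>u + v = x\<close> is listed separately because
    \<open>x\<close> is not in \<open>P\<close>.\<close>
  have P_left: "u \<in> P" if "u \<in> \<Lambda>" "v \<in> \<Lambda>" "0 < u" "0 < v" "u + v \<in> P \<or> u + v = x" for u v
  proof (cases "u + v = x")
    case True
    with that show ?thesis by (auto simp: P_iff)
  next
    case False
    with that have "u + v \<in> P" by blast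
    then have "v + (x - (u + v)) \<in> \<Lambda>" and lt: "u + v < x"
      using that add[of v "x - (u + v)"] by (simp_all add: P_iff)
    moreover have "v + (x - (u + v)) = x - u" using lt by simp
    ultimately have "x - u \<in> \<Lambda>" by metis
    with that lt show ?thesis by (simp add: P_iff)
  qed
  have P_split: "\<exists>u\<in>P. \<exists>v\<in>P. u \<le> v \<and> y = u + v" if y: "y \<in> P" "y \<notin> A" for y
  proof -
    obtain u v where "u \<in> \<Lambda> - {0}" "v \<in> \<Lambda> - {0}" "y = u + v"
      using y unfolding A P_iff by blast
    moreover from this have "u \<in> P" "v \<in> P"
      using P_left[of u v] P_left[of v u] y(1) by (auto simp: add.commute)
    ultimately show ?thesis by (metis add.commute nat_le_linear)
  qed
  have A_not_sum: "u + v \<notin> A" if "u \<in> P" "v \<in> P" for u v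
    using that by (auto simp: A P_iff)
  have P_sum3: "u + v \<in> P" if "u \<in> P" "v \<in> P" "w \<in> P" "u + v + w \<in> P \<or> u + v + w = x" for u v w
    using that add by (intro P_left[of "u + v" w]) (auto simp: P_iff)

  have len: "length (sorted_list_of_set P) = 5"
    using cardP by simp
  then obtain b1 b2 b3 b4 b5 where bs: "sorted_list_of_set P = [b1, b2, b3, b4, b5]"
    by (auto simp: numeral_eq_Suc length_Suc_conv simp del: sorted_list_of_set.length_sorted_key_list_of_set)
  have Pb: "P = {b1, b2, b3, b4, b5}"
    using set_sorted_list_of_set[OF finP] bs by simp
  have "sorted_wrt (<) [b1, b2, b3, b4, b5]"
    using strict_sorted_list_of_set[of P] bs by simp
  then have "b1 < b2" "b2 < b3" "b3 < b4" "b4 < b5" by auto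
  moreover have "0 < b1" "b5 < x"
    using P_iff Pb by blast+
  ultimately have ord: "0 < b1" "b1 < b2" "b2 < b3" "b3 < b4" "b4 < b5" "b5 < x"
    by simp_all
  have "map (\<lambda>y. x - y) (rev (sorted_list_of_set P)) = sorted_list_of_set P"
    by (rule sorted_list_of_set_reflect[OF finP]) (auto simp: P_iff)
  \<comment> \<open>Comparing the list with its reflection entry by entry pairs b1 with b5, b2 with
    b4, and makes the middle entry its own complement.\<close>
  then have refl: "x = b1 + b5" "x = b2 + b4" "x = 2 * b3"
    using bs ord by auto

  have P_cases: "y = b1 \<or> y = b2 \<or> y = b3 \<or> y = b4 \<or> y = b5" if "y \<in> P" for y
    using that Pb by auto
  \<comment> \<open>A non-generator in \<open>P\<close> is a sum of two members that stays below x =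
    b1 + b5 = b2 + b4 = 2 * b3. So b5 is never a summand, b4 goes only with b1, and two summands
    from b3 on are too large; six sums remain.\<close>
  have gen: thesis
    if "y \<in> P" "y \<in> A \<Longrightarrow> thesis"
      "y = 2 * b1 \<Longrightarrow> thesis" "y = b1 + b2 \<Longrightarrow> thesis" "y = b1 + b3 \<Longrightarrow> thesis"
      "y = b1 + b4 \<Longrightarrow> thesis" "y = 2 * b2 \<Longrightarrow> thesis" "y = b2 + b3 \<Longrightarrow> thesis" for y thesis
  proof (cases "y \<in> A")
    case False
    then obtain u v where "u \<in> P" "v \<in> P" "u \<le> v" "y = u + v"
      using P_split \<open>y \<in> P\<close> by blast
    moreover have "y < x" using \<open>y \<in> P\<close> P_iff by blast
    ultimately have "(u = b1 \<and> v \<noteq> b5) \<or> (u = b2 \<and> (v = b2 \<or> v = b3))" "v \<noteq> b1 \<or> u = b1"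
      using P_cases[of u] P_cases[of v] ord refl by auto
    then show thesis
      using that(3-) P_cases[OF \<open>v \<in> P\<close>] \<open>y = u + v\<close> by (auto simp: mult_2)
  qed (use that in blast)
  have gen1: "b1 \<in> A"
    by (rule gen[of b1]) (use Pb ord in auto)
  have gen2: "b2 \<in> A \<or> b2 = 2 * b1"
    by (rule gen[of b2]) (use Pb ord in auto)
  have gen3: "b3 \<in> A \<or> b3 = 2 * b1 \<or> b3 = b1 + b2 \<or> b3 = 2 * b2"
    by (rule gen[of b3]) (use Pb ord in auto)
  have gen4: "b4 \<in> A \<or> b4 = 2 * b1 \<or> b4 = b1 + b2 \<or> b4 = 2 * b2 \<or> b4 = b1 + b3 \<or> b4 = b2 + b3"
    by (rule gen[of b4]) (use Pb ord in auto)
  have gen5: "b5 \<in> A \<or> b5 = 2 * b1 \<or> b5 = b1 + b2 \<or> b5 = 2 * b2 \<or> b5 = b1 + b3 \<or> b5 = b2 + b3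
      \<or> b5 = b1 + b4"
    by (rule gen[of b5]) (use Pb in auto)

  show ?thesis
  proof (cases "b2 \<in> A")
    case False
    then have b2: "b2 = 2 * b1" using gen2 by simp
    show ?thesis
    proof (cases "3 * b1 \<in> P")
      case True
      \<comment> \<open>The element 3 * b1 exceeds b2. As b3 it gives 6 * b1 and as b4 it gives 5 *
        b1; as b5 it would give x = 4 * b1, hence b3 = b2.\<close>
      then have "x = 6 * b1 \<or> x = 5 * b1"
        using P_cases[OF True] ord refl b2 by auto
      then show ?thesis
      proof
        assume x: "x = 5 * b1"
        then have "b3 \<in> A"
          using gen3 refl ord b2 by auto
        moreover have "distinct [b1, b3]" using ord by simp
        ultimately show ?thesis using gen1 x refl
          by - (rule disjI2[OF disjI2[OF disjI1]], blast)
      qed (use gen1 in \<open>intro disjI1, blast\<close>)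
    next
      case False
      have no3: "b1 + b2 \<notin> P" using False b2 by simp
      \<comment> \<open>Once 3 * b1 is not in \<open>P\<close>, neither \<open>x\<close> nor any
        member of \<open>P\<close> has the form 3 * b1 + w with w in \<open>P\<close>.\<close>
      have no3': "b1 + b2 + w \<noteq> x \<and> b1 + b2 + w \<notin> P" if "w \<in> P" for w
        using P_sum3[of b1 b2 w] that no3 Pb by blast
      have "b3 \<noteq> b1 + b2" "b4 \<noteq> b1 + b2" "b3 \<noteq> 2 * b2" "b4 \<noteq> 2 * b2"
        using no3 no3'[of b1] b2 Pb by auto
      then have b3: "b3 \<in> A" and "b4 \<in> A \<or> b4 = b1 + b3 \<or> b4 = b2 + b3"
        using gen3 gen4 ord b2 by auto
      moreover have "b4 \<noteq> b1 + b3"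
        using no3'[of b3] refl Pb by auto
      \<comment> \<open>Otherwise 2 * b3 = x = 2 * b2 + b3, so b3 = 4 * b1 = 3 * b1 + b1.\<close>
      moreover have "b4 \<noteq> b2 + b3"
        using refl(2,3) no3'[of b1] b2 Pb by auto
      ultimately have "b4 \<in> A" by simp
      moreover have "x = 2 * b1 + b4" "distinct [b3, b1, b4]"
        using refl b2 ord by auto
      ultimately show ?thesis using b3 gen1 refl(3)
        by - (rule disjI2[OF disjI2[OF disjI2[OF disjI2[OF disjI2[OF disjI1]]]]], blast)
    qed
  next
    case b2: True
    have ne2: "b2 \<noteq> 2 * b1"
      using A_not_sum[of b1 b1] b2 Pb by (auto simp: mult_2)
    consider (gen3A) "b3 \<in> A" | (double1) "b3 = 2 * b1" | (sum) "b3 = b1 + b2" | (double2) "b3 = 2 * b2"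
      using gen3 by blast
    then show ?thesis
    proof cases
      case double1
      then have x: "x = 4 * b1" using refl by simp
      consider "b4 \<in> A" | "b4 = b1 + b2" | "b4 = 2 * b2"
        using gen4 double1 refl ord by fastforce
      then show ?thesis
      proof cases
        case 1
        have "distinct [b1, b2, b4]" using ord by simp
        then show ?thesis using 1 x refl(2) gen1 b2
          by - (rule disjI2[OF disjI2[OF disjI2[OF disjI1]]], blast)
      next
        case 2
        then have "3 * b1 = 2 * b2" "distinct [b1, b2]"
          using refl x ord by auto
        then show ?thesis using x gen1 b2
          by - (rule disjI2[OF disjI2[OF disjI2[OF disjI2[OF disjI1]]]], blast)
      next
        case 3
        then have "x = 3 * b2" "distinct [b1, b2]"
          using refl ord by auto
        then show ?thesis using x gen1 b2
          by - (rule disjI2[OF disjI1], blast)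
      qed
    next
      case sum
      \<comment> \<open>Here x = 2 * b1 + 2 * b2, so 2 * b1 divides \<open>x\<close>. It lies
        strictly between b1 and b3 = b1 + b2, which leaves only b2, a generator.\<close>
      have "2 * b1 \<in> P"
        using refl sum Pb add P_iff[of b1] P_iff[of b2] ord
        by (intro P_left[of "2 * b1" "2 * b2"]) (auto simp: mult_2)
      then have False
        using P_cases[of "2 * b1"] sum ord ne2 by auto
      then show ?thesis ..
    next
      case double2
      then have x: "x = 4 * b2" using refl by simp
      \<comment> \<open>Sums without b3 or b4 are at most 2 * b2 = b3. Inserting the others into x =
        b1 + b5 = 4 * b2 forces b1 = b2, or b2 = 2 * b1 for b1 + b4.\<close>
      have "b5 \<in> A"
        using gen5 double2 refl ord ne2 by (elim disjE) simp_all
      moreover have "distinct [b2, b1, b5]" using ord by simp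
      ultimately show ?thesis using x refl(1) gen1 b2
        by - (rule disjI2[OF disjI2[OF disjI2[OF disjI1]]], blast)
    next
      case gen3A
      have ne3: "b3 \<noteq> 2 * b1" "b3 \<noteq> b1 + b2" "b3 \<noteq> 2 * b2"
        using A_not_sum[of b1 b1] A_not_sum[of b1 b2] A_not_sum[of b2 b2] gen3A Pb by (auto simp: mult_2)
      consider (twice) "x = 2 * b1 + b2 \<or> x = 2 * b2 + b1"
        | (both) "b4 \<in> A" "b5 \<in> A" | (three1) "b4 \<in> A" "x = 3 * b1" | (three2) "x = 3 * b2" "b5 \<in> A"
      proof -
        \<comment> \<open>Adding the complement b2 of b4, and below the complement b1 of b5, turns
          each decomposition into one of \<open>x\<close>. Those involving b3 cancel against x = 2 *
          b3 and contradict \<open>ne3\<close>; b5 = b1 + b4 would give b2 = 2 * b1.\<close>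
        have g4: "b4 \<in> A \<or> x = 2 * b1 + b2 \<or> x = 2 * b2 + b1 \<or> x = 3 * b2"
          using gen4 refl ord ne3 by (elim disjE) simp_all
        have g5: "b5 \<in> A \<or> x = 3 * b1 \<or> x = 2 * b1 + b2 \<or> x = 2 * b2 + b1"
          using gen5 refl ord ne2 ne3 by (elim disjE) simp_all
        \<comment> \<open>Thus outside the case \<open>twice\<close> at most one of b4 and b5 fails
          to be a generator.\<close>
        have "\<not> (x = 3 * b1 \<and> x = 3 * b2)" using ord by simp
        with g4 g5 that show thesis by blast
      qed
      then show ?thesis
      proof cases
        case twice
        have "distinct [b3, b1, b2]" "distinct [b3, b2, b1]" using ord by auto
        with twice show ?thesis using refl(3) gen3A gen1 b2
          by - (rule disjI2[OF disjI2[OF disjI2[OF disjI2[OF disjI2[OF disjI1]]]]], blast)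
      next
        case both
        have "distinct [b3, b1, b5, b2, b4]" using ord by auto
        with both show ?thesis using refl gen3A gen1 b2
          by - (rule disjI2[OF disjI2[OF disjI2[OF disjI2[OF disjI2[OF disjI2[OF disjI2]]]]]], blast)
      next
        case three1
        have "distinct [b1, b3, b2, b4]" using ord by auto
        with three1 show ?thesis using refl gen3A gen1 b2
          by - (rule disjI2[OF disjI2[OF disjI2[OF disjI2[OF disjI2[OF disjI2[OF disjI1]]]]]], blast)
      next
        case three2
        have "distinct [b2, b3, b1, b5]" using ord by auto
        with three2 show ?thesis using refl gen3A gen1 b2
          by - (rule disjI2[OF disjI2[OF disjI2[OF disjI2[OF disjI2[OF disjI2[OF disjI1]]]]]], blast)
      qed
    qed
  qed
qed

end
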